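(* For every C*-factor $A$ one of the following holds: (a) $A$ is of type $I_n$ for some natural number $n$; (b) $A$ is of type $I_n$ for some infinite cardinal number $n$; (c) $A$ is of type $II_1$; (d) $A$ is of type $II_\infty$; (e) $A$ is of type III.
   Context: A C*-algebra $A$ is a C*-factor if it has no nonzero proper two-sided ideals $I,J$ with $IJ=\{ab:a\in I,b\in J\}=\{0\}$. For a C*-algebra $B$ and $S\subseteq B$, $\mathrm{Ann}_B(S)=\{a\in B: as+sa=0\ \forall s\in S\}$; $\mathcal{P}_B=\{\mathrm{Ann}_B(\mathrm{Ann}_B(S)): S\subseteq B_+\}$ is the lattice of annihilators (ordered by inclusion, complete; suprema taken in $\mathcal{P}_B$). For $V\subseteq B$, ${}^dV=\{a\in B: xay+yax=0\ \forall x,y\in V\}$. $V\in\mathcal{P}_B$ is central if ${}^d(\mathrm{Ann}_B(\mathrm{Ann}_B(S)))\cap{}^d(\mathrm{Ann}_B(S))=\{0\}$ where $S\subseteq B_+$, $V=\mathrm{Ann}_B(\mathrm{Ann}_B(S))$. The central support $c(V)$ is the greatest lower bound in $\mathcal{P}_B$ of central annihilators containing $V$. $V$ is Abelian if commutative; $V,W$ are orthogonal if $\{vw\}=\{0\}$. Each $V\in\mathcal{P}_B$ is a C*-subalgebra; $V$ is modular if $\mathcal{P}_V$ (computed inside $V$) is a modular lattice. $\mathcal{P}_B$ is locally modular if there is a family of modular annihilators $\{V_\xi\}$ whose central supports $\{Z_\xi\}$ are pairwise orthogonal with $\sup_\xi Z_\xi=B$; purely nonmodular if there is no nonzero modular annihilator.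 Types: for a cardinal $n$, $B$ is of type $I_n$ if there is a family $\{P_i\}_{i\in\Xi}$, $|\Xi|=n$, of pairwise orthogonal Abelian annihilators with central support $B$ and $\sup_iP_i=B$; $B$ is of type $II_1$ if $\mathcal{P}_B$ is modular; of type $II_\infty$ if $\mathcal{P}_B$ is locally modular and the annihilator $B$ is not modular; of type III if $\mathcal{P}_B$ is purely nonmodular. *)

theory Defs
  imports "HOL-Analysis.Analysis"
begin

class cstar_algebra = real_normed_algebra + banach +
  fixes cscale :: "complex \<Rightarrow> 'a \<Rightarrow> 'a"
    and star :: "'a \<Rightarrow> 'a"
  assumes cscale_add_right: "cscale c (x + y) = cscale c x + cscale c y"
    and cscale_add_left: "cscale (a + b) x = cscale a x + cscale b x"
    and cscale_cscale: "cscale a (cscale b x) = cscale (a * b) x"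
    and cscale_one: "cscale 1 x = x"
    and cscale_of_real: "cscale (complex_of_real r) x = scaleR r x"
    and norm_cscale: "norm (cscale c x) = cmod c * norm x"
    and cscale_mult_left: "cscale c x * y = cscale c (x * y)"
    and cscale_mult_right: "x * cscale c y = cscale c (x * y)"
    and star_star: "star (star x) = x"
    and star_add: "star (x + y) = star x + star y"
    and star_cscale: "star (cscale c x) = cscale (cnj c) (star x)"
    and star_mult: "star (x * y) = star y * star x"
    and cstar_identity: "norm (star x * x) = (norm x)\<^sup>2"

definition two_sided_ideal :: "'a::cstar_algebra set \<Rightarrow> bool" where
  "two_sided_ideal I \<longleftrightarrow> 0 \<in> I \<and> (\<forall>x\<in>I. \<forall>y\<in>I. x + y \<in> I)
     \<and> (\<forall>c. \<forall>x\<in>I. cscale c x \<in> I)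
     \<and> (\<forall>x\<in>I. \<forall>b. b * x \<in> I \<and> x * b \<in> I)"

definition c_factor :: "'a::cstar_algebra itself \<Rightarrow> bool" where
  "c_factor _ \<longleftrightarrow> \<not> (\<exists>I J :: 'a set. two_sided_ideal I \<and> two_sided_ideal J
      \<and> I \<noteq> {0} \<and> I \<noteq> UNIV \<and> J \<noteq> {0} \<and> J \<noteq> UNIV
      \<and> {a * b | a b. a \<in> I \<and> b \<in> J} = {0})"

section \<open>Annihilators, relative to a C*-subalgebra V (e.g. V = UNIV)\<close>

definition pos :: "'a::cstar_algebra set \<Rightarrow> 'a set" where
  "pos V = {star x * x | x. x \<in> V}"

definition Ann :: "'a::cstar_algebra set \<Rightarrow> 'a set \<Rightarrow> 'a set" where
  "Ann V S = {a \<in> V. \<forall>s\<in>S. a * s + s * a = 0}"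

definition annis :: "'a::cstar_algebra set \<Rightarrow> 'a set set" where
  "annis V = {Ann V (Ann V S) | S. S \<subseteq> pos V}"

definition lubP :: "'a set set \<Rightarrow> 'a set set \<Rightarrow> 'a set" where
  "lubP P X = (THE u. u \<in> P \<and> (\<forall>x\<in>X. x \<subseteq> u) \<and> (\<forall>v\<in>P. (\<forall>x\<in>X. x \<subseteq> v) \<longrightarrow> u \<subseteq> v))"

definition glbP :: "'a set set \<Rightarrow> 'a set set \<Rightarrow> 'a set" where
  "glbP P X = (THE u. u \<in> P \<and> (\<forall>x\<in>X. u \<subseteq> x) \<and> (\<forall>v\<in>P. (\<forall>x\<in>X. v \<subseteq> x) \<longrightarrow> v \<subseteq> u))"

definition dAnn :: "'a::cstar_algebra set \<Rightarrow> 'a set \<Rightarrow> 'a set" where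
  "dAnn V W = {a \<in> V. \<forall>x\<in>W. \<forall>y\<in>W. x * a * y + y * a * x = 0}"

definition central_ann :: "'a::cstar_algebra set \<Rightarrow> 'a set \<Rightarrow> bool" where
  "central_ann B V \<longleftrightarrow> (\<exists>S. S \<subseteq> pos B \<and> V = Ann B (Ann B S)
      \<and> dAnn B (Ann B (Ann B S)) \<inter> dAnn B (Ann B S) = {0})"

definition central_support :: "'a::cstar_algebra set \<Rightarrow> 'a set \<Rightarrow> 'a set" where
  "central_support B V = glbP (annis B) {Z \<in> annis B. central_ann B Z \<and> V \<subseteq> Z}"

definition abelian :: "'a::cstar_algebra set \<Rightarrow> bool" where
  "abelian V \<longleftrightarrow> (\<forall>x\<in>V. \<forall>y\<in>V. x * y = y * x)"

definition orth :: "'a::cstar_algebra set \<Rightarrow> 'a set \<Rightarrow> bool" where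
  "orth V W \<longleftrightarrow> {v * w | v w. v \<in> V \<and> w \<in> W} = {0}"

definition modular_lattice :: "'a set set \<Rightarrow> bool" where
  "modular_lattice P \<longleftrightarrow> (\<forall>x\<in>P. \<forall>y\<in>P. \<forall>z\<in>P. x \<subseteq> z \<longrightarrow>
      lubP P {x, glbP P {y, z}} = glbP P {lubP P {x, y}, z})"

definition modular_ann :: "'a::cstar_algebra set \<Rightarrow> bool" where
  "modular_ann V \<longleftrightarrow> modular_lattice (annis V)"

definition locally_modular :: "'a::cstar_algebra set \<Rightarrow> bool" where
  "locally_modular B \<longleftrightarrow> (\<exists>\<V>. \<V> \<subseteq> annis B \<and> (\<forall>V\<in>\<V>. modular_ann V)
      \<and> (\<forall>V\<in>\<V>. \<forall>W\<in>\<V>. V \<noteq> W \<longrightarrow> orth (central_support B V) (central_support B W))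
      \<and> lubP (annis B) (central_support B ` \<V>) = B)"

definition purely_nonmodular :: "'a::cstar_algebra set \<Rightarrow> bool" where
  "purely_nonmodular B \<longleftrightarrow> \<not> (\<exists>V\<in>annis B. V \<noteq> {0} \<and> modular_ann V)"

definition typeI_family :: "'a::cstar_algebra set \<Rightarrow> 'a set set \<Rightarrow> bool" where
  "typeI_family B F \<longleftrightarrow> F \<subseteq> annis B \<and> (\<forall>P\<in>F. abelian P)
      \<and> (\<forall>P\<in>F. \<forall>Q\<in>F. P \<noteq> Q \<longrightarrow> orth P Q)
      \<and> (\<forall>P\<in>F. central_support B P = B)
      \<and> lubP (annis B) F = B"

definition typeI_fin :: "'a::cstar_algebra set \<Rightarrow> nat \<Rightarrow> bool" where
  "typeI_fin B n \<longleftrightarrow> (\<exists>F. typeI_family B F \<and> finite F \<and> card F = n)"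

definition typeI_infinite :: "'a::cstar_algebra set \<Rightarrow> bool" where
  "typeI_infinite B \<longleftrightarrow> (\<exists>F. typeI_family B F \<and> infinite F)"

definition typeII_1 :: "'a::cstar_algebra set \<Rightarrow> bool" where
  "typeII_1 B \<longleftrightarrow> modular_lattice (annis B)"

definition typeII_inf :: "'a::cstar_algebra set \<Rightarrow> bool" where
  "typeII_inf B \<longleftrightarrow> locally_modular B \<and> \<not> modular_ann B"

definition typeIII :: "'a::cstar_algebra set \<Rightarrow> bool" where
  "typeIII B \<longleftrightarrow> purely_nonmodular B"

end

theory Submission
  imports Defs
begin

text \<open>
  Everything rests on the fact that an element a anticommuting with s = x* x satisfies a s = 0.
  For self-adjoint a put k = a s, which is skew-adjoint, and h = x a x*, which is self-adjoint;
  k and h are of the form g x and x g, so their nonzero spectra agree and lie in both the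
  imaginary and the real line.  Norm estimates replace the spectral theory: averaging
  (1 + c k)^3 k over c = t, it, -t, -it isolates the term linear in c, and gives
  3 t |k| \<le> (1 + t^2 |k|^2)^(3/2) for all t, which forces k = 0.

  Consequently an annihilator V and its complement W satisfy V W = W V = 0.  If V is central then
  V A W = 0, since its elements lie in both of the sets whose intersection is assumed trivial.
  In a C*-factor this makes V or W zero, so every nonzero annihilator has full central support.
  Hence a single nonzero modular annihilator makes the lattice locally modular, and already one
  of the types II_1, II_infinity, III occurs.
\<close>

section \<open>Norm estimates\<close>

lemma cscale_zero_left [simp]: "cscale 0 x = (0::'a::cstar_algebra)"
  using cscale_of_real[of 0 x] by simp

lemma cscale_zero_right [simp]: "cscale c (0::'a::cstar_algebra) = 0"
  using cscale_add_right[of c 0 0] by simp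

lemma cscale_minus_right: "cscale c (- x) = - cscale c (x::'a::cstar_algebra)"
  by (rule minus_unique[symmetric]) (simp flip: cscale_add_right)

lemma cscale_minus_left: "cscale (- c) x = - cscale c (x::'a::cstar_algebra)"
  by (rule minus_unique[symmetric]) (simp flip: cscale_add_left)

lemma cscale_diff_right: "cscale c (x - y) = cscale c x - cscale c (y::'a::cstar_algebra)"
  using cscale_add_right[of c x "- y"] by (simp add: cscale_minus_right)

lemma star_zero [simp]: "star (0::'a::cstar_algebra) = 0"
  using star_add[of "0::'a" 0] by simp

lemma star_minus: "star (- x) = - star (x::'a::cstar_algebra)"
  by (rule minus_unique[symmetric]) (simp flip: star_add)

lemma star_diff: "star (x - y) = star x - star (y::'a::cstar_algebra)"
  using star_add[of x "- y"] by (simp add: star_minus)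

lemma star_mult_self_eq_0_iff [simp]: "star x * x = 0 \<longleftrightarrow> x = (0::'a::cstar_algebra)"
  using cstar_identity[of x] by auto

lemma mult_star_self_eq_0_iff [simp]: "x * star x = 0 \<longleftrightarrow> x = (0::'a::cstar_algebra)"
proof -
  have "star x = 0 \<longleftrightarrow> x = 0" using star_star[of x] by auto
  then show ?thesis using star_mult_self_eq_0_iff[of "star x"] by (simp add: star_star)
qed

lemma norm_star [simp]: "norm (star x) = norm (x::'a::cstar_algebra)"
proof -
  have le: "norm y \<le> norm (star y)" for y :: 'a
  proof (cases "y = 0")
    case False
    have "norm y * norm y \<le> norm (star y) * norm y"
      using norm_mult_ineq[of "star y" y] by (simp add: cstar_identity power2_eq_square)
    then show ?thesis using False by simp
  qed simp
  show ?thesis using le[of x] le[of "star x"] by (simp add: star_star)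
qed

text \<open>Normality rearranges \<open>star (y * y) * (y * y)\<close> into the square of the
  self-adjoint \<open>star y * y\<close>, so the C*-identity can be applied at both levels.\<close>

lemma norm_square_normal:
  fixes y :: "'a::cstar_algebra"
  assumes "star y * y = y * star y"
  shows "norm (y * y) = (norm y)\<^sup>2"
proof -
  have "star (y * y) * (y * y) = star (star y * y) * (star y * y)"
  proof -
    have "star (y * y) * (y * y) = star y * ((star y * y) * y)"
      by (simp add: star_mult mult.assoc)
    also have "\<dots> = star y * ((y * star y) * y)" by (simp only: assms)
    finally show ?thesis by (simp add: star_mult star_star mult.assoc)
  qed
  then have "(norm (y * y))\<^sup>2 = ((norm y)\<^sup>2)\<^sup>2"
    unfolding cstar_identity[symmetric] by simp
  then show ?thesis
    by (rule power2_eq_imp_eq) simp_all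
qed

text \<open>
  The hypotheses pass from (y, D) to (y^2, D^2) with the same constant C, so that iteration
  removes C; this replaces a comparison of spectral radii.
\<close>
lemma norm_le_of_intertwining:
  fixes y x :: "'a::cstar_algebra"
  assumes "star y * y = y * star y"
    and "\<And>z. norm (x * (y * z)) \<le> D * norm (x * z)"
    and "\<And>z. norm (y * z) \<le> C * D * norm (x * z)"
    and "0 < D" "0 \<le> C"
  shows "norm y \<le> D"
proof -
  have iter: "norm y ^ (2 ^ m) \<le> C * norm x * D ^ (2 ^ m)"
    if "star y * y = y * star y"
      "\<And>z. norm (x * (y * z)) \<le> D * norm (x * z)"
      "\<And>z. norm (y * z) \<le> C * D * norm (x * z)" "0 < D"
    for m and y :: 'a and D
    using that
  proof (induction m arbitrary: y D)
    case 0
    show ?case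
    proof (cases "y = 0")
      case True
      then show ?thesis using \<open>0 < D\<close> \<open>0 \<le> C\<close> by simp
    next
      case False
      \<comment> \<open>A unit need not exist, so the norm of \<open>y\<close> is read off by
        testing the third hypothesis at \<open>z = star y\<close>.\<close>
      have "norm y * norm y = norm (y * star y)"
        using cstar_identity[of "star y"] by (simp add: star_star power2_eq_square)
      also have "\<dots> \<le> C * D * norm (x * star y)" by (rule 0)
      also have "\<dots> \<le> C * D * (norm x * norm y)"
        using norm_mult_ineq[of x "star y"] \<open>0 < D\<close> \<open>0 \<le> C\<close>
        by (intro mult_left_mono) auto
      finally have "norm y * norm y \<le> (C * norm x * D) * norm y" by (simp add: ac_simps)
      then show ?thesis using False by simp
    qed
  next
    case (Suc m)
    have n2: "star (y * y) * (y * y) = (y * y) * star (y * y)"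
    proof -
      have *: "star y * (y * z) = y * (star y * z)" for z
        using Suc.prems(1) by (simp flip: mult.assoc)
      show ?thesis by (simp add: star_mult mult.assoc * Suc.prems(1))
    qed
    have a2: "norm (x * (y * y * z)) \<le> D\<^sup>2 * norm (x * z)" for z
    proof -
      have "norm (x * (y * (y * z))) \<le> D * norm (x * (y * z))" by (rule Suc.prems)
      also have "\<dots> \<le> D * (D * norm (x * z))"
        using Suc.prems by (intro mult_left_mono) auto
      finally show ?thesis by (simp add: power2_eq_square mult.assoc)
    qed
    have b2: "norm (y * y * z) \<le> C * D\<^sup>2 * norm (x * z)" for z
    proof -
      have "norm (y * (y * z)) \<le> C * D * norm (x * (y * z))" by (rule Suc.prems)
      also have "\<dots> \<le> C * D * (D * norm (x * z))"
        using Suc.prems \<open>0 \<le> C\<close> by (intro mult_left_mono) auto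
      finally show ?thesis by (simp add: power2_eq_square mult.assoc)
    qed
    have "norm (y * y) ^ (2 ^ m) \<le> C * norm x * (D\<^sup>2) ^ (2 ^ m)"
      by (rule Suc.IH[OF n2 a2 b2]) (use Suc.prems in auto)
    then show ?case
      by (simp add: norm_square_normal[OF Suc.prems(1)] flip: power_mult)
  qed
  show ?thesis
  proof (rule ccontr)
    assume "\<not> norm y \<le> D"
    then have r: "1 < norm y / D" using \<open>0 < D\<close> by simp
    obtain n where n: "C * norm x < (norm y / D) ^ n"
      using real_arch_pow[OF r] by blast
    have "(norm y / D) ^ n \<le> (norm y / D) ^ (2 ^ n)"
      using r by (intro power_increasing) (auto intro: less_imp_le)
    also have "\<dots> = norm y ^ (2 ^ n) / D ^ (2 ^ n)" by (simp add: power_divide)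
    also have "\<dots> \<le> C * norm x"
      using iter[OF assms(1-4), of n] \<open>0 < D\<close> by (simp add: pos_divide_le_eq)
    finally show False using n by simp
  qed
qed

section \<open>The cubic (1 + p)^3 b and its bound for skew p\<close>

text \<open>This is (1 + p)^3 b multiplied out. Since the algebra need not have a unit, the power
  acts on a second argument \<open>b\<close>.\<close>

definition one_plus_cubed :: "'a::cstar_algebra \<Rightarrow> 'a \<Rightarrow> 'a" where
  "one_plus_cubed p b = b + 3 *\<^sub>R (p * b) + 3 *\<^sub>R (p * (p * b)) + p * (p * (p * b))"

lemma one_plus_cubed_alt:
  fixes p b :: "'a::cstar_algebra"
  shows
  "one_plus_cubed p b = (let e = \<lambda>b. b + p * b in e (e (e b)))"
proof -
  have "3 *\<^sub>R x = x + x + x" for x :: 'a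
    using scaleR_add_left[of 1 2 x] by (simp add: scaleR_2 add.assoc)
  then show ?thesis by (simp add: one_plus_cubed_def Let_def distrib_left add_ac)
qed

text \<open>For skew \<open>p\<close> the cross terms in
  \<open>star (b + p * b) * (b + p * b)\<close> cancel, and the C*-identity leaves a Pythagorean
  bound: in effect |1 + p|^2 \<le> 1 + |p|^2.\<close>

lemma norm_add_skew_mult:
  fixes p b :: "'a::cstar_algebra"
  assumes "star p = - p"
  shows "norm (b + p * b) \<le> sqrt (1 + (norm p)\<^sup>2) * norm b"
proof -
  have "star (b + p * b) * (b + p * b) = star b * b + star (p * b) * (p * b)"
    using assms by (simp add: star_add star_mult algebra_simps)
  then have "(norm (b + p * b))\<^sup>2 = norm (star b * b + star (p * b) * (p * b))"
    using cstar_identity[of "b + p * b"] by simp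
  also have "\<dots> \<le> (norm b)\<^sup>2 + (norm (p * b))\<^sup>2"
    using norm_triangle_ineq[of "star b * b" "star (p * b) * (p * b)"]
    unfolding cstar_identity .
  also have "\<dots> \<le> (norm b)\<^sup>2 + (norm p * norm b)\<^sup>2"
    by (intro add_left_mono power_mono norm_mult_ineq norm_ge_zero)
  also have "\<dots> = (sqrt (1 + (norm p)\<^sup>2) * norm b)\<^sup>2"
    by (simp add: power_mult_distrib algebra_simps)
  finally show ?thesis
    by (rule power2_le_imp_le) simp
qed

lemma norm_one_plus_cubed_skew:
  fixes p b :: "'a::cstar_algebra"
  assumes "star p = - p" "norm p \<le> M"
  shows "norm (one_plus_cubed p b) \<le> sqrt (1 + M\<^sup>2) ^ 3 * norm b"
proof -
  define q where "q = sqrt (1 + M\<^sup>2)"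
  have "sqrt (1 + (norm p)\<^sup>2) \<le> q"
    unfolding q_def using assms(2) by (simp add: power_mono)
  then have e: "norm (b + p * b) \<le> q * norm b" for b
    using norm_add_skew_mult[OF assms(1), of b] by (meson mult_right_mono norm_ge_zero order_trans)
  have q: "0 \<le> q" by (simp add: q_def)
  define e' where "e' = (\<lambda>b. b + p * b)"
  have e': "norm (e' b) \<le> q * norm b" for b by (simp add: e'_def e)
  have "norm (e' (e' (e' b))) \<le> q * norm (e' (e' b))" by (rule e')
  also have "\<dots> \<le> q * (q * norm (e' b))" by (intro mult_left_mono e' q)
  also have "\<dots> \<le> q * (q * (q * norm b))" by (intro mult_left_mono e' q)
  finally show ?thesis
    by (simp only: one_plus_cubed_alt e'_def Let_def q_def power3_eq_cube mult.assoc)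
qed

text \<open>This carries a bound for the cubic in \<open>r\<close> over to the cubic in
  \<open>p\<close> when only \<open>r\<close> is skew.\<close>

lemma one_plus_cubed_intertwine:
  fixes x p r :: "'a::cstar_algebra"
  assumes "x * p = r * x"
  shows "x * one_plus_cubed p b = one_plus_cubed r (x * b)"
proof -
  have "x * (p * z) = r * (x * z)" for z
    using assms by (metis mult.assoc)
  then show ?thesis by (simp add: one_plus_cubed_def algebra_simps)
qed

lemma one_plus_cubed_mult:
  fixes p :: "'a::cstar_algebra"
  shows "one_plus_cubed p b * z = one_plus_cubed p (b * z)"
  by (simp add: one_plus_cubed_def algebra_simps)

lemma one_plus_cubed_commute:
  fixes p b u :: "'a::cstar_algebra"
  assumes "u * p = p * u" "u * b = b * u"
  shows "u * one_plus_cubed p b = one_plus_cubed p b * u"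
  using one_plus_cubed_intertwine[OF assms(1)] assms(2) by (simp add: one_plus_cubed_mult)

section \<open>Vanishing of anticommuting products\<close>

lemma skew_product_eq_0:
  fixes g x :: "'a::cstar_algebra"
  assumes skew: "star (g * x) = - (g * x)" and self: "star (x * g) = x * g"
  shows "g * x = 0"
proof (rule ccontr)
  define k h where "k = g * x" and "h = x * g"
  assume "g * x \<noteq> 0"
  then have k0: "0 < norm k" by (simp add: k_def)
  have sk: "star k = - k" and sh: "star h = h" using skew self by (simp_all add: k_def h_def)
  \<comment> \<open>\<open>h\<close> is normal, \<open>g * h = k * g\<close> and
    \<open>h = x * g\<close>; \<open>C\<close> is chosen so that \<open>C * D\<close> becomes
    \<open>norm x\<close>.\<close>
  have hk: "norm h \<le> norm k"
  proof (rule norm_le_of_intertwining[where x = g and C = "norm x / norm k"])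
    show "norm (g * (h * z)) \<le> norm k * norm (g * z)" for z
      using norm_mult_ineq[of k "g * z"] by (simp add: k_def h_def mult.assoc)
    show "norm (h * z) \<le> norm x / norm k * norm k * norm (g * z)" for z
      using norm_mult_ineq[of x "g * z"] k0 by (simp add: h_def mult.assoc)
  qed (use sh k0 in auto)
  \<comment> \<open>Put u = t^2 |k|^2. The final inequality, squared, reads 9 u \<le> (1 + u)^3 and
    fails at u = 1/2. The first or second power in place of the cube would give u \<le> 1 + u or 4 u
    \<le> (1 + u)^2, which never fail.\<close>
  define t where "t = 1 / (sqrt 2 * norm k)"
  have t0: "0 < t" using k0 by (simp add: t_def)
  have tk: "(t * norm k)\<^sup>2 = 1 / 2"
    using k0 by (simp add: t_def power_divide power_mult_distrib field_simps)
  define B where "B = sqrt (1 + (t * norm k)\<^sup>2) ^ 3"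
  have B0: "0 < B" by (simp add: B_def tk)
  have real_case: "norm (one_plus_cubed (cscale (of_real c) k) k) \<le> B * norm k"
    if "\<bar>c\<bar> = t" for c
    unfolding B_def by (rule norm_one_plus_cubed_skew)
      (use that in \<open>simp_all add: star_cscale sk cscale_minus_right norm_cscale\<close>)
  have imag_case: "norm (one_plus_cubed (cscale (\<i> * of_real c) k) k) \<le> B * norm k"
    if c: "\<bar>c\<bar> = t" for c
  proof -
    \<comment> \<open>Here \<open>p\<close> is self-adjoint, so the skew bound does not apply to it.
      It does apply to \<open>r\<close>, and passes to \<open>y\<close> through
      \<open>x * p = r * x\<close> and \<open>g * r = p * g\<close>.\<close>
    define p r where "p = cscale (\<i> * of_real c) k" and "r = cscale (\<i> * of_real c) h"
    define y where "y = one_plus_cubed p k"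
    have sr: "star r = - r"
      by (simp add: r_def star_cscale sh cscale_minus_left)
    have nr: "norm r \<le> t * norm k"
      using c hk t0 by (simp add: r_def norm_cscale norm_mult)
    have xp: "x * p = r * x" and gr: "g * r = p * g"
      by (simp_all add: p_def r_def k_def h_def cscale_mult_left cscale_mult_right mult.assoc)
    have Br: "norm (one_plus_cubed r b) \<le> B * norm b" for b
      unfolding B_def by (rule norm_one_plus_cubed_skew[OF sr nr])
    \<comment> \<open>\<open>y\<close> is a polynomial in the skew element \<open>k\<close>, so
      \<open>star y\<close> commutes with \<open>k\<close> and therefore with
      \<open>y\<close>.\<close>
    have ky: "k * y = y * k"
      unfolding y_def by (rule one_plus_cubed_commute)
        (simp_all add: p_def cscale_mult_left cscale_mult_right)
    then have sky: "star y * k = k * star y"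
      by (metis sk star_mult mult_minus_left mult_minus_right minus_equation_iff)
    then have "star y * y = y * star y"
      unfolding y_def by (intro one_plus_cubed_commute)
        (simp_all add: p_def cscale_mult_left cscale_mult_right flip: y_def)
    moreover have "norm (x * (y * z)) \<le> (B * norm k) * norm (x * z)" for z
    proof -
      have "x * (y * z) = one_plus_cubed r (h * (x * z))"
        unfolding y_def one_plus_cubed_mult one_plus_cubed_intertwine[OF xp]
        by (simp add: k_def h_def mult.assoc)
      then have "norm (x * (y * z)) \<le> B * norm (h * (x * z))" using Br by simp
      also have "\<dots> \<le> B * (norm k * norm (x * z))"
        using B0 order_trans[OF norm_mult_ineq mult_right_mono[OF hk norm_ge_zero]]
        by (intro mult_left_mono) auto
      finally show ?thesis by (simp add: mult.assoc)
    qed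
    moreover have "norm (y * z) \<le> norm g / norm k * (B * norm k) * norm (x * z)" for z
    proof -
      have "y * z = g * one_plus_cubed r (x * z)"
        unfolding y_def one_plus_cubed_mult one_plus_cubed_intertwine[OF gr]
        by (simp add: k_def mult.assoc)
      then have "norm (y * z) \<le> norm g * norm (one_plus_cubed r (x * z))"
        by (simp add: norm_mult_ineq)
      also have "\<dots> \<le> norm g * (B * norm (x * z))"
        by (intro mult_left_mono Br norm_ge_zero)
      finally show ?thesis using k0 by (simp add: mult.assoc)
    qed
    ultimately show ?thesis
      unfolding y_def[symmetric] p_def[symmetric]
      by (rule norm_le_of_intertwining) (use B0 k0 in auto)
  qed
  define Y where "Y = (\<lambda>c. one_plus_cubed (cscale c k) k)"
  have Y: "Y c = k + cscale (3 * c) (k * k) + cscale (3 * c^2) (k * (k * k))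
      + cscale (c^3) (k * (k * (k * k)))" for c
    using cscale_of_real[of 3 "k * k", symmetric]
    by (simp add: Y_def one_plus_cubed_def cscale_mult_left cscale_mult_right cscale_cscale
        power2_eq_square power3_eq_cube mult.assoc flip: cscale_of_real)
  have odd: "Y c - Y (- c) = cscale (6 * c) (k * k) + cscale (2 * c^3) (k * (k * (k * k)))" for c
    using cscale_add_left[of "3 * c" "3 * c" "k * k"]
      cscale_add_left[of "c^3" "c^3" "k * (k * (k * k))"]
    by (simp add: Y cscale_minus_left)
  \<comment> \<open>The weight \<open>- \<i>\<close> doubles the term linear in \<open>c\<close>, as
    \<open>- \<i> * \<i> = 1\<close>, and cancels the one in \<open>c^3\<close>, as
    \<open>- \<i> * \<i>^3 = -1\<close>.\<close>
  have avg: "(Y c - Y (- c)) - cscale \<i> (Y (\<i> * c) - Y (- (\<i> * c))) = cscale (12 * c) (k * k)" for c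
    unfolding odd using cscale_add_left[of "6 * c" "6 * c" "k * k"]
    by (simp add: cscale_add_right cscale_cscale power_mult_distrib power3_eq_cube
        cscale_minus_left cscale_diff_right mult.assoc mult.left_commute)
  have n: "norm (Y c) \<le> B * norm k" if "c \<in> {of_real t, - of_real t, \<i> * of_real t, - (\<i> * of_real t)}" for c
    using that real_case[of t] real_case[of "- t"] imag_case[of t] imag_case[of "- t"] t0
    unfolding Y_def by auto
  have "12 * t * (norm k)\<^sup>2 = norm (cscale (12 * of_real t) (k * k))"
    using norm_square_normal[of k] sk t0 by (simp add: norm_cscale norm_mult)
  also have "\<dots> \<le> norm (Y (of_real t) - Y (- of_real t)) + norm (Y (\<i> * of_real t) - Y (- (\<i> * of_real t)))"
    unfolding avg[symmetric] by (rule order_trans[OF norm_triangle_ineq4]) (simp add: norm_cscale)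
  also have "\<dots> \<le> (norm (Y (of_real t)) + norm (Y (- of_real t))) + (norm (Y (\<i> * of_real t)) + norm (Y (- (\<i> * of_real t))))"
    by (intro add_mono norm_triangle_ineq4)
  also have "\<dots> \<le> 4 * (B * norm k)"
    using n[of "of_real t"] n[of "- of_real t"] n[of "\<i> * of_real t"] n[of "- (\<i> * of_real t)"] by simp
  finally have "(3 * (t * norm k)) * norm k \<le> B * norm k"
    by (simp add: power2_eq_square)
  then have "3 * (t * norm k) \<le> B" using k0 by simp
  then have "(3 * (t * norm k))\<^sup>2 \<le> B\<^sup>2" using k0 t0 by (intro power_mono) auto
  moreover have "(3 * (t * norm k))\<^sup>2 = 9 / 2" using tk by (simp add: power_mult_distrib)
  moreover have "B\<^sup>2 = 27 / 8"
  proof -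
    have "B = sqrt (3 / 2) ^ 3" by (simp add: B_def tk)
    then have "B\<^sup>2 = ((sqrt (3 / 2))\<^sup>2) ^ 3" by (simp only: power_mult[symmetric] mult.commute)
    then show ?thesis by (simp add: power3_eq_cube)
  qed
  ultimately show False by simp
qed

text \<open>Since \<open>s\<close> is self-adjoint, \<open>star a\<close> anticommutes with it too,
  and so do the self-adjoint elements \<open>a + star a\<close> and
  \<open>cscale \<i> (a - star a)\<close>. Both reduce to \<open>skew_product_eq_0\<close>.\<close>

lemma anticommute_pos_eq_0:
  fixes a s :: "'a::cstar_algebra"
  assumes "s \<in> pos UNIV" and "a * s + s * a = 0"
  shows "a * s = 0" "s * a = 0"
proof -
  obtain x where s: "s = star x * x" using assms(1) by (auto simp: pos_def)
  have ss: "star s = s" by (simp add: s star_mult star_star)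
  have *: "b * s = 0" if b: "star b = b" "b * s + s * b = 0" for b
  proof -
    have "b * star x * x = 0"
    proof (rule skew_product_eq_0)
      have "star (b * s) = - (b * s)"
        using b ss by (simp add: star_mult eq_neg_iff_add_eq_0 add.commute)
      then show "star (b * star x * x) = - (b * star x * x)" by (simp add: s mult.assoc)
      show "star (x * (b * star x)) = x * (b * star x)"
        using b by (simp add: star_mult star_star mult.assoc)
    qed
    then show ?thesis by (simp add: s mult.assoc)
  qed
  have a': "star a * s + s * star a = 0"
    using arg_cong[OF assms(2), of star] ss by (simp add: star_add star_mult add.commute)
  have 1: "(a + star a) * s = 0"
  proof (rule *)
    show "star (a + star a) = a + star a" by (simp add: star_add star_star add.commute)
    have "(a + star a) * s + s * (a + star a) = (a * s + s * a) + (star a * s + s * star a)"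
      by (simp only: distrib_left distrib_right ac_simps)
    then show "(a + star a) * s + s * (a + star a) = 0" using assms(2) a' by simp
  qed
  have anti: "(a - star a) * s + s * (a - star a) = 0"
  proof -
    have "(a - star a) * s + s * (a - star a) = (a * s + s * a) - (star a * s + s * star a)"
      by (simp add: left_diff_distrib right_diff_distrib)
    then show ?thesis using assms(2) a' by simp
  qed
  have 2: "cscale \<i> (a - star a) * s = 0"
  proof (rule *)
    show "star (cscale \<i> (a - star a)) = cscale \<i> (a - star a)"
      by (simp add: star_cscale star_diff star_star cscale_minus_left cscale_diff_right)
    show "cscale \<i> (a - star a) * s + s * cscale \<i> (a - star a) = 0"
      by (simp add: cscale_mult_left cscale_mult_right anti flip: cscale_add_right)
  qed
  have "(a - star a) * s = cscale (- \<i>) (cscale \<i> (a - star a) * s)"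
    unfolding cscale_mult_left cscale_cscale by (simp add: cscale_one)
  then have 3: "(a - star a) * s = 0" using 2 by simp
  have "2 *\<^sub>R (a * s) = (a + star a) * s + (a - star a) * s"
    by (simp add: distrib_right left_diff_distrib scaleR_2)
  then show "a * s = 0" using 1 3 by simp
  then show "s * a = 0" using assms(2) by simp
qed

section \<open>Central annihilators\<close>

lemma Ann_pos_iff:
  fixes S :: "'a::cstar_algebra set"
  assumes "S \<subseteq> pos UNIV"
  shows "a \<in> Ann UNIV S \<longleftrightarrow> (\<forall>s\<in>S. a * s = 0 \<and> s * a = 0)"
  using assms anticommute_pos_eq_0 by (fastforce simp: Ann_def)

text \<open>\<open>w\<close> need not be positive, so \<open>v\<close> is tested against
  \<open>star u * u\<close> for \<open>u = w\<close> and \<open>u = star w\<close>. These lie in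
  \<open>Ann UNIV S\<close> because by \<open>Ann_pos_iff\<close> it is closed under products and
  the involution. The C*-identity then removes the extra factor.\<close>

lemma Ann_Ann_mult_eq_0:
  fixes S :: "'a::cstar_algebra set"
  assumes S: "S \<subseteq> pos UNIV" and v: "v \<in> Ann UNIV (Ann UNIV S)" and w: "w \<in> Ann UNIV S"
  shows "v * w = 0" "w * v = 0"
proof -
  have sa: "star s = s" if "s \<in> S" for s
    using that S by (auto simp: pos_def star_mult star_star)
  have w': "star w \<in> Ann UNIV S"
    using w sa unfolding Ann_pos_iff[OF S] by (metis star_mult star_star star_zero)
  have vu: "v * (star u * u) = 0" "(star u * u) * v = 0"
    if u: "u \<in> Ann UNIV S" "star u \<in> Ann UNIV S" for u
  proof -
    have "star u * u \<in> Ann UNIV S"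
      using u unfolding Ann_pos_iff[OF S] by (metis mult.assoc mult_zero_left mult_zero_right)
    then have "v * (star u * u) + (star u * u) * v = 0"
      using v by (simp add: Ann_def)
    moreover have "star u * u \<in> pos UNIV" by (auto simp: pos_def)
    ultimately show "v * (star u * u) = 0" "(star u * u) * v = 0"
      using anticommute_pos_eq_0 by blast+
  qed
  have "star (w * v) * (w * v) = star v * ((star w * w) * v)"
    by (simp add: star_mult mult.assoc)
  then show "w * v = 0" using vu(2)[OF w w'] by simp
  have "(v * w) * star (v * w) = v * (star (star w) * star w) * star v"
    by (simp add: star_mult star_star mult.assoc)
  then show "v * w = 0" using vu(1)[of "star w"] w w' by (simp add: star_star)
qed

lemma mult_star_mult_eq_0:
  fixes z :: "'a::cstar_algebra"
  assumes "z * star z * z = 0"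
  shows "z = 0"
proof -
  have "star (star z * z) * (star z * z) = star z * (z * star z * z)"
    by (simp add: star_mult star_star mult.assoc)
  then show ?thesis using assms by simp
qed

section \<open>Orthogonal ideals and central annihilators in a factor\<close>

lemma c_factor_orthogonal:
  fixes V W :: "'a::cstar_algebra set"
  assumes "c_factor TYPE('a)" and VW: "\<And>v b w. v \<in> V \<Longrightarrow> w \<in> W \<Longrightarrow> v * (b * w) = 0"
  shows "V \<subseteq> {0} \<or> W \<subseteq> {0}"
proof (rule ccontr)
  assume nz: "\<not> (V \<subseteq> {0} \<or> W \<subseteq> {0})"
  \<comment> \<open>Taking annihilators instead of generated ideals makes closure under sums
    immediate; \<open>W \<subseteq> J\<close> is the hypothesis and \<open>V \<subseteq> I\<close>
    holds by construction.\<close>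
  define J where "J = {j. \<forall>v\<in>V. \<forall>b. v * (b * j) = 0}"
  define I where "I = {i. \<forall>j\<in>J. \<forall>b. i * (b * j) = 0}"
  have J: "two_sided_ideal J"
    unfolding two_sided_ideal_def
  proof (intro conjI ballI allI)
    fix j c assume "j \<in> J"
    then have *: "v * (b * j) = 0" if "v \<in> V" for v b using that by (simp add: J_def)
    show "c * j \<in> J" unfolding J_def using *[where b = "_ * c"] by (simp add: mult.assoc)
    have "v * (b * (j * c)) = v * (b * j) * c" for v b by (simp add: mult.assoc)
    then show "j * c \<in> J" unfolding J_def using * by simp
  qed (simp_all add: J_def distrib_left cscale_mult_right)
  have I: "two_sided_ideal I"
    unfolding two_sided_ideal_def
  proof (intro conjI ballI allI)
    fix i c assume "i \<in> I"
    then have *: "i * (b * j) = 0" if "j \<in> J" for b j using that by (simp add: I_def)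
    show "i * c \<in> I" unfolding I_def using *[where b = "c * _"] by (simp add: mult.assoc)
    show "c * i \<in> I" unfolding I_def using * by (simp add: mult.assoc)
  qed (simp_all add: I_def distrib_right cscale_mult_left)
  have ij: "i * j = 0" if "i \<in> I" "j \<in> J" for i j
  proof (rule mult_star_mult_eq_0)
    have "i * ((j * star (i * j) * i) * j) = 0" using that by (simp add: I_def)
    then show "i * j * star (i * j) * (i * j) = 0" by (simp add: mult.assoc)
  qed
  have "V \<subseteq> I" "W \<subseteq> J" using VW by (auto simp: I_def J_def)
  then obtain i j where i: "i \<in> I" "i \<noteq> 0" and j: "j \<in> J" "j \<noteq> 0" using nz by blast
  \<comment> \<open>If \<open>I\<close> were everything, it would contain \<open>star j\<close>, and
    \<open>star j * j = 0\<close> would force \<open>j = 0\<close>; similarly for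
    \<open>J\<close>.\<close>
  have "I \<noteq> UNIV" using ij[of "star j" j] j by auto
  moreover have "J \<noteq> UNIV" using ij[of i "star i"] i by auto
  moreover have "0 \<in> I" "0 \<in> J" using I J by (auto simp: two_sided_ideal_def)
  then have "{a * b | a b. a \<in> I \<and> b \<in> J} = {0}"
    using ij by (auto intro!: exI[of _ 0])
  moreover have "I \<noteq> {0}" "J \<noteq> {0}" using i j by auto
  ultimately show False using assms(1) I J unfolding c_factor_def by blast
qed

lemma central_ann_c_factor:
  fixes Z :: "'a::cstar_algebra set"
  assumes "c_factor TYPE('a)" and "central_ann UNIV Z" and "\<not> Z \<subseteq> {0}"
  shows "Z = UNIV"
proof -
  obtain S where S: "S \<subseteq> pos UNIV" and Z: "Z = Ann UNIV (Ann UNIV S)"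
    and d: "dAnn UNIV Z \<inter> dAnn UNIV (Ann UNIV S) = {0}"
    using assms(2) unfolding central_ann_def by auto
  note orth = Ann_Ann_mult_eq_0[OF S, folded Z]
  have "v * (b * w) = 0" if v: "v \<in> Z" and w: "w \<in> Ann UNIV S" for v b w
  proof -
    have "x * (v * (b * w)) * y = 0" if "x \<in> Ann UNIV S" for x y
      using orth(2)[OF v that] by (metis mult.assoc mult_zero_left)
    moreover have "x * (v * (b * w)) * y = 0" if "y \<in> Z" for x y
      using orth(2)[OF that w] by (simp add: mult.assoc)
    \<comment> \<open>For factors from \<open>Ann UNIV S\<close> the left one kills
      \<open>v\<close>; for factors from \<open>Z\<close> the right one is killed by
      \<open>w\<close>. Either way both summands in \<open>dAnn\<close> vanish.\<close>
    ultimately have "v * (b * w) \<in> dAnn UNIV Z \<inter> dAnn UNIV (Ann UNIV S)"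
      by (simp add: dAnn_def)
    then show ?thesis using d by simp
  qed
  then have "Ann UNIV S \<subseteq> {0}"
    using c_factor_orthogonal[OF assms(1)] assms(3) by blast
  then show ?thesis by (auto simp: Z Ann_def)
qed

section \<open>The whole algebra as an annihilator, and central supports\<close>

lemma Ann_pos_UNIV: "Ann UNIV (pos UNIV) = {0::'a::cstar_algebra}"
proof -
  have "a = 0" if "a \<in> Ann UNIV (pos UNIV)" for a :: 'a
  proof -
    have "star a * a \<in> pos UNIV" unfolding pos_def by blast
    then have "a * (star a * a) = 0"
      using that unfolding Ann_pos_iff[OF order_refl] by blast
    then have "a * star a * a = 0" unfolding mult.assoc .
    then show ?thesis by (rule mult_star_mult_eq_0)
  qed
  moreover have "0 \<in> Ann UNIV (pos UNIV)" by (simp add: Ann_def)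
  ultimately show ?thesis by blast
qed

lemma Ann_Ann_pos_UNIV: "Ann UNIV (Ann UNIV (pos UNIV)) = (UNIV::'a::cstar_algebra set)"
  unfolding Ann_pos_UNIV by (simp add: Ann_def)

lemma UNIV_in_annis: "UNIV \<in> annis (UNIV::'a::cstar_algebra set)"
  unfolding annis_def mem_Collect_eq
  by (intro exI[of _ "pos UNIV"]) (simp add: Ann_Ann_pos_UNIV)

text \<open>It ensures that the family of central annihilators above any \<open>V\<close>, whose
  greatest lower bound is the central support, is nonempty.\<close>

lemma central_ann_UNIV: "central_ann UNIV (UNIV::'a::cstar_algebra set)"
proof -
  have "a = 0" if "a \<in> dAnn UNIV UNIV" for a :: 'a
  proof -
    \<comment> \<open>Both test elements in \<open>dAnn\<close> are taken to be
      \<open>star a\<close>.\<close>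
    have "star a * a * star a + star a * a * star a = 0"
      using that unfolding dAnn_def by blast
    then have "2 *\<^sub>R (star a * a * star a) = 0" by (simp only: scaleR_2)
    then have "star a * star (star a) * star a = 0" by (simp add: star_star)
    then have "star a = 0" by (rule mult_star_mult_eq_0)
    then show ?thesis by (metis star_star star_zero)
  qed
  moreover have "0 \<in> dAnn UNIV (UNIV::'a set) \<inter> dAnn UNIV {0}" by (simp add: dAnn_def)
  ultimately have "dAnn UNIV UNIV \<inter> dAnn UNIV {0} = {0::'a}" by blast
  then show ?thesis
    unfolding central_ann_def
    by (intro exI[of _ "pos UNIV"]) (simp only: Ann_Ann_pos_UNIV, simp add: Ann_pos_UNIV)
qed

text \<open>By \<open>central_ann_c_factor\<close> the whole algebra is the only central annihilator
  above a nonzero \<open>V\<close>, so the greatest lower bound is that of a single set.\<close>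

lemma central_support_c_factor:
  fixes V :: "'a::cstar_algebra set"
  assumes "c_factor TYPE('a)" and "V \<in> annis UNIV" and "V \<noteq> {0}"
  shows "central_support UNIV V = UNIV"
proof -
  have "0 \<in> V" using assms(2) by (auto simp: annis_def Ann_def)
  then have "\<not> Z \<subseteq> {0}" if "V \<subseteq> Z" for Z using assms(3) that by blast
  then have "{Z \<in> annis UNIV. central_ann UNIV Z \<and> V \<subseteq> Z} = {UNIV}"
    using central_ann_c_factor[OF assms(1)] UNIV_in_annis central_ann_UNIV by blast
  then show ?thesis
    unfolding central_support_def glbP_def
    using UNIV_in_annis by (intro the_equality) auto
qed

section \<open>The type alternative\<close>

theorem theorem30:
  assumes "c_factor TYPE('a::cstar_algebra)"
  shows "(\<exists>n::nat. typeI_fin (UNIV::'a set) n)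
       \<or> typeI_infinite (UNIV::'a set)
       \<or> typeII_1 (UNIV::'a set)
       \<or> typeII_inf (UNIV::'a set)
       \<or> typeIII (UNIV::'a set)"
proof (cases "typeIII (UNIV::'a set) \<or> typeII_1 (UNIV::'a set)")
  case False
  then obtain V :: "'a set" where V: "V \<in> annis UNIV" "V \<noteq> {0}" "modular_ann V"
    by (auto simp: typeIII_def purely_nonmodular_def)
  have "lubP (annis UNIV) {UNIV} = (UNIV::'a set)"
    unfolding lubP_def using UNIV_in_annis by (intro the_equality) auto
  \<comment> \<open>The family \<open>{V}\<close> suffices: pairwise orthogonality is vacuous, and
    its only central support is the whole algebra.\<close>
  then have "locally_modular (UNIV::'a set)"
    unfolding locally_modular_def
    using V by (intro exI[of _ "{V}"]) (simp add: central_support_c_factor[OF assms])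
  \<comment> \<open>For the whole algebra \<open>typeII_1\<close> and \<open>modular_ann\<close> are
    the same condition, so its failure turns local modularity into
    \<open>typeII_inf\<close>.\<close>
  then show ?thesis
    using False by (simp add: typeII_inf_def typeII_1_def modular_ann_def)
qed blast

end
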